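(* Let $G$ and $H$ be groups. Then $G \wr H$ is cyclic subgroup separable if and only if both $G$ and $H$ are cyclic subgroup separable and either $G$ is abelian or $H$ is finite.
   Context: $G \wr H$ denotes the regular restricted wreath product $\left(\bigoplus_{h \in H} G\right) \rtimes H$, where $H$ permutes the coordinates by the regular action. A subset $A$ of a group $G$ is separable in $G$ if for every $g \in G \setminus A$ there is a homomorphism $\varphi: G \to Q$ with $Q$ finite and $\varphi(g) \notin \varphi(A)$. A group is cyclic subgroup separable if each of its cyclic subgroups is separable in it. *)

theory Defs
  imports "HOL-Algebra.Algebra"
begin

(* Every finite group is isomorphic to one whose carrier is a set of natural numbers, so letting Q
   range over "nat monoid" loses no finite quotient; see separable_in_witness. *)
definition separable_in :: "'a set \<Rightarrow> ('a, 'c) monoid_scheme \<Rightarrow> bool" where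
  "separable_in A G \<longleftrightarrow>
     (\<forall>g \<in> carrier G - A. \<exists>(Q :: nat monoid) \<phi>.
        group Q \<and> finite (carrier Q) \<and> \<phi> \<in> hom G Q \<and> \<phi> g \<notin> \<phi> ` A)"

definition cyclic_subgroup_separable :: "('a, 'c) monoid_scheme \<Rightarrow> bool" where
  "cyclic_subgroup_separable G \<longleftrightarrow> (\<forall>a \<in> carrier G. separable_in (generate G {a}) G)"

definition semidirect_product ::
  "('n, 'c) monoid_scheme \<Rightarrow> ('h, 'd) monoid_scheme \<Rightarrow> ('h \<Rightarrow> 'n \<Rightarrow> 'n) \<Rightarrow> ('n \<times> 'h) monoid" where
  "semidirect_product N H \<alpha> =
     \<lparr>carrier = carrier N \<times> carrier H,
      monoid.mult = (\<lambda>(n, h) (n', h'). (n \<otimes>\<^bsub>N\<^esub> \<alpha> h n', h \<otimes>\<^bsub>H\<^esub> h')),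
      one = (\<one>\<^bsub>N\<^esub>, \<one>\<^bsub>H\<^esub>)\<rparr>"

(* The left regular action: h moves the entry at coordinate y to coordinate h y, so the new entry
   at x is the old one at h^{-1} x. *)
definition regular_shift :: "('h, 'd) monoid_scheme \<Rightarrow> 'h \<Rightarrow> ('h \<Rightarrow> 'g) \<Rightarrow> 'h \<Rightarrow> 'g" where
  "regular_shift H h f = (\<lambda>x \<in> carrier H. f (inv\<^bsub>H\<^esub> h \<otimes>\<^bsub>H\<^esub> x))"

definition wreath_product ::
  "('g, 'c) monoid_scheme \<Rightarrow> ('h, 'd) monoid_scheme \<Rightarrow> (('h \<Rightarrow> 'g) \<times> 'h) monoid" where
  "wreath_product G H =
     semidirect_product (sum_group (carrier H) (\<lambda>_. G)) H (regular_shift H)"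

lemma separable_in_witness:
  fixes Q :: "('b, 'd) monoid_scheme"
  assumes "group Q" "finite (carrier Q)" "\<phi> \<in> hom G Q" "A \<subseteq> carrier G" "g \<in> carrier G"
    and "\<phi> g \<notin> \<phi> ` A"
  shows "\<exists>(Q' :: nat monoid) \<psi>.
    group Q' \<and> finite (carrier Q') \<and> \<psi> \<in> hom G Q' \<and> \<psi> g \<notin> \<psi> ` A"
proof -
  interpret Q: group Q by fact
  obtain e :: "'b \<Rightarrow> nat" where e: "inj_on e (carrier Q)"
    using finite_imp_inj_to_nat_seg[OF assms(2)] by blast
  define d where "d = the_inv_into (carrier Q) e"
  have de[simp]: "d (e x) = x" if "x \<in> carrier Q" for x
    using the_inv_into_f_f[OF e that] by (simp add: d_def)
  define Q' :: "nat monoid" where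
    "Q' = \<lparr>carrier = e ` carrier Q, monoid.mult = (\<lambda>x y. e (d x \<otimes>\<^bsub>Q\<^esub> d y)), one = e \<one>\<^bsub>Q\<^esub>\<rparr>"
  have "group Q'"
  proof (rule groupI)
    fix x assume "x \<in> carrier Q'"
    then obtain y where y: "y \<in> carrier Q" "x = e y" by (auto simp: Q'_def)
    then show "\<exists>z\<in>carrier Q'. z \<otimes>\<^bsub>Q'\<^esub> x = \<one>\<^bsub>Q'\<^esub>"
      by (intro bexI[of _ "e (inv\<^bsub>Q\<^esub> y)"]) (auto simp: Q'_def)
  qed (auto simp: Q'_def Q.m_assoc)
  moreover have "finite (carrier Q')" using assms(2) by (simp add: Q'_def)
  moreover have "e \<circ> \<phi> \<in> hom G Q'"
    using assms(3) by (auto simp: hom_def Q'_def Pi_iff)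
  moreover have "(e \<circ> \<phi>) g \<notin> (e \<circ> \<phi>) ` A"
  proof
    assume "(e \<circ> \<phi>) g \<in> (e \<circ> \<phi>) ` A"
    then obtain a where a: "a \<in> A" "e (\<phi> g) = e (\<phi> a)" by auto
    then have "\<phi> g = \<phi> a"
      using e assms(3-5) by (auto simp: inj_on_def hom_def Pi_iff)
    then show False using a assms(6) by auto
  qed
  ultimately show ?thesis by blast
qed

lemma group_semidirect_product:
  assumes "group N" "group H"
    and cl: "\<And>h n. h \<in> carrier H \<Longrightarrow> n \<in> carrier N \<Longrightarrow> \<alpha> h n \<in> carrier N"
    and mult: "\<And>h n n'. h \<in> carrier H \<Longrightarrow> n \<in> carrier N \<Longrightarrow> n' \<in> carrier N \<Longrightarrow>
      \<alpha> h (n \<otimes>\<^bsub>N\<^esub> n') = \<alpha> h n \<otimes>\<^bsub>N\<^esub> \<alpha> h n'"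
    and one: "\<And>n. n \<in> carrier N \<Longrightarrow> \<alpha> \<one>\<^bsub>H\<^esub> n = n"
    and act: "\<And>h h' n. h \<in> carrier H \<Longrightarrow> h' \<in> carrier H \<Longrightarrow> n \<in> carrier N \<Longrightarrow>
      \<alpha> (h \<otimes>\<^bsub>H\<^esub> h') n = \<alpha> h (\<alpha> h' n)"
  shows "group (semidirect_product N H \<alpha>)"
proof -
  interpret N: group N by fact
  interpret H: group H by fact
  show ?thesis
  proof (rule groupI)
    fix x assume "x \<in> carrier (semidirect_product N H \<alpha>)"
    then obtain n h where x: "x = (n, h)" "n \<in> carrier N" "h \<in> carrier H"
      by (auto simp: semidirect_product_def)
    let ?m = "\<alpha> (inv\<^bsub>H\<^esub> h) (inv\<^bsub>N\<^esub> n)"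
    have "?m \<otimes>\<^bsub>N\<^esub> \<alpha> (inv\<^bsub>H\<^esub> h) n = \<alpha> (inv\<^bsub>H\<^esub> h) \<one>\<^bsub>N\<^esub>"
      using x by (simp flip: mult)
    also have "\<dots> = \<one>\<^bsub>N\<^esub>"
      using x mult[of "inv\<^bsub>H\<^esub> h" "\<one>\<^bsub>N\<^esub>" "\<one>\<^bsub>N\<^esub>"] cl[of "inv\<^bsub>H\<^esub> h" "\<one>\<^bsub>N\<^esub>"]
      by (metis H.inv_closed N.l_cancel_one N.one_closed N.r_one)
    finally show "\<exists>y\<in>carrier (semidirect_product N H \<alpha>).
        y \<otimes>\<^bsub>semidirect_product N H \<alpha>\<^esub> x = \<one>\<^bsub>semidirect_product N H \<alpha>\<^esub>"
      using x by (intro bexI[of _ "(?m, inv\<^bsub>H\<^esub> h)"]) (auto simp: semidirect_product_def cl)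
  qed (auto simp: semidirect_product_def cl mult one act N.m_assoc H.m_assoc)
qed

lemma group_wreath_product:
  assumes "group G" "group H"
  shows "group (wreath_product G H)"
proof -
  interpret G: group G by fact
  interpret H: group H by fact
  have carr: "carrier (sum_group (carrier H) (\<lambda>_. G)) =
      {f \<in> carrier H \<rightarrow>\<^sub>E carrier G. finite {i \<in> carrier H. f i \<noteq> \<one>\<^bsub>G\<^esub>}}"
    by (simp add: carrier_sum_group)
  show ?thesis
    unfolding wreath_product_def
  proof (rule group_semidirect_product)
    fix h f assume h: "h \<in> carrier H" and f: "f \<in> carrier (sum_group (carrier H) (\<lambda>_. G))"
    have "{x \<in> carrier H. f (inv\<^bsub>H\<^esub> h \<otimes>\<^bsub>H\<^esub> x) \<noteq> \<one>\<^bsub>G\<^esub>} \<subseteq>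
        (\<lambda>y. h \<otimes>\<^bsub>H\<^esub> y) ` {i \<in> carrier H. f i \<noteq> \<one>\<^bsub>G\<^esub>}"
    proof
      fix x assume x: "x \<in> {x \<in> carrier H. f (inv\<^bsub>H\<^esub> h \<otimes>\<^bsub>H\<^esub> x) \<noteq> \<one>\<^bsub>G\<^esub>}"
      then have "x = h \<otimes>\<^bsub>H\<^esub> (inv\<^bsub>H\<^esub> h \<otimes>\<^bsub>H\<^esub> x)"
        using h by (simp flip: H.m_assoc)
      then show "x \<in> (\<lambda>y. h \<otimes>\<^bsub>H\<^esub> y) ` {i \<in> carrier H. f i \<noteq> \<one>\<^bsub>G\<^esub>}"
        using x h by blast
    qed
    then have "finite {x \<in> carrier H. f (inv\<^bsub>H\<^esub> h \<otimes>\<^bsub>H\<^esub> x) \<noteq> \<one>\<^bsub>G\<^esub>}"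
      using f carr finite_surj by blast
    then show "regular_shift H h f \<in> carrier (sum_group (carrier H) (\<lambda>_. G))"
      using h f by (auto simp: carr regular_shift_def cong: conj_cong)
  next
    fix f assume "f \<in> carrier (sum_group (carrier H) (\<lambda>_. G))"
    then show "regular_shift H \<one>\<^bsub>H\<^esub> f = f"
      by (auto simp: carr regular_shift_def PiE_iff extensional_def)
  qed (use assms in \<open>auto simp: regular_shift_def H.inv_mult_group H.m_assoc\<close>)
qed

end

theory Submission
  imports Defs
begin

text \<open>
  No finite quotient of the wreath product is injective on an infinite top group \<open>H\<close>, so the
  quotient identifies two different coordinate copies of \<open>G\<close>; as these commute, the image of
  \<open>G\<close> is abelian.

  Conversely, multiplying \<open>g\<close> by a power of \<open>w\<close> reduces the separation of \<open>g\<close> from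
  \<open>\<langle>w\<rangle>\<close>, \<open>w = (f\<^sub>0, h)\<close>, to \<open>g = (f, 1)\<close>. If \<open>h\<close> has finite order \<open>n\<close>, then \<open>\<langle>w\<rangle>\<close> meets
  the base group in the powers of \<open>F = w\<^sup>n\<close>, and \<open>f\<close> has to be kept apart from these in a
  finite power of a finite quotient of \<open>G\<close>. For infinite \<open>H\<close> and abelian \<open>G\<close> one first passes to
  \<open>G \<wr> H/N\<close> by multiplying the entries in each coset, where \<open>N\<close> has finite index
  and separates all relevant coordinates. If \<open>h\<close> has infinite order, \<open>f\<close> does not
  commute with \<open>w\<close>, and it suffices to preserve this in the quotient.
\<close>

section \<open>Normal subgroups of finite index\<close>

text \<open>Finite quotients are handled through their kernels: unlike homomorphisms into varying
  groups, these can be intersected to meet several conditions at once.\<close>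

definition finite_index_normal :: "'a set \<Rightarrow> ('a, 'c) monoid_scheme \<Rightarrow> bool" where
  "finite_index_normal N G \<longleftrightarrow> N \<lhd> G \<and> finite (rcosets\<^bsub>G\<^esub> N)"

lemma finite_index_normal_carrier:
  fixes G (structure)
  assumes "group G"
  shows "finite_index_normal (carrier G) G"
proof -
  interpret group G by fact
  have "rcosets (carrier G) \<subseteq> {carrier G}"
    using coset_join2[OF _ subgroup_self] by (auto simp: RCOSETS_def)
  then show ?thesis
    unfolding finite_index_normal_def
    using finite_subset[of _ "{carrier G}"] by (auto intro: normal_invI subgroup_self)
qed

lemma (in group) r_coset_Int:
  assumes "subgroup M G" "subgroup N G" "x \<in> carrier G"
  shows "(M \<inter> N) #> x = (M #> x) \<inter> (N #> x)"
proof -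
  have sub: "M \<subseteq> carrier G" "N \<subseteq> carrier G"
    using assms subgroup.subset by blast+
  have "m \<in> N" if "m \<in> M" "n \<in> N" "m \<otimes> x = n \<otimes> x" for m n
    using that sub assms(3) by (metis r_cancel subsetD)
  then show ?thesis
    by (force simp: r_coset_def)
qed

lemma finite_index_normal_Int:
  fixes G (structure)
  assumes "group G" "finite_index_normal M G" "finite_index_normal N G"
  shows "finite_index_normal (M \<inter> N) G"
proof -
  interpret group G by fact
  have sub: "subgroup M G" "subgroup N G"
    using assms(2,3) by (auto simp: finite_index_normal_def normal_imp_subgroup)
  \<comment> \<open>A coset of the intersection is an intersection of two cosets, so there are only
    finitely many.\<close>
  have "rcosets (M \<inter> N) \<subseteq> (\<lambda>(A, B). A \<inter> B) ` ((rcosets M) \<times> (rcosets N))"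
    using r_coset_Int[OF sub] by (fastforce simp: RCOSETS_def)
  moreover have "finite ((rcosets M) \<times> (rcosets N))"
    using assms(2,3) by (simp add: finite_index_normal_def)
  ultimately have "finite (rcosets (M \<inter> N))"
    using finite_surj by blast
  moreover have "M \<inter> N \<lhd> G"
    using assms(2,3) normal_Int_subgroup
    by (auto simp: finite_index_normal_def intro!: normal_invI subgroups_Inter_pair sub
        dest: normal.inv_op_closed2)
  ultimately show ?thesis by (simp add: finite_index_normal_def)
qed

text \<open>Intersecting the subgroups found for each \<open>i\<close> keeps the index finite
  because \<open>I\<close> is finite. The sets \<open>C i\<close> may be infinite.\<close>

lemma finite_index_normal_avoids:
  assumes "group G" "finite I"
    and "\<And>i. i \<in> I \<Longrightarrow> \<exists>N. finite_index_normal N G \<and> N \<inter> C i = {}"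
  shows "\<exists>N. finite_index_normal N G \<and> (\<forall>i\<in>I. N \<inter> C i = {})"
  using assms(2,3)
proof (induction I)
  case empty
  then show ?case using finite_index_normal_carrier[OF assms(1)] by auto
next
  case (insert i I)
  then obtain M N where "finite_index_normal M G" "M \<inter> C i = {}"
    "finite_index_normal N G" "\<forall>i\<in>I. N \<inter> C i = {}"
    by (metis insertCI)
  then show ?case
    by (intro exI[of _ "M \<inter> N"]) (auto simp: finite_index_normal_Int[OF assms(1)])
qed

lemma finite_index_normal_kernel:
  assumes "group G" "group Q" "finite (carrier Q)" "\<phi> \<in> hom G Q"
  shows "finite_index_normal (kernel G Q \<phi>) G"
proof -
  interpret group_hom G Q \<phi>
    using assms by (simp add: group_hom_def group_hom_axioms_def)
  have "(\<lambda>K. the_elem (\<phi> ` K)) ` carrier (G Mod kernel G Q \<phi>) \<subseteq> carrier Q"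
    using FactGroup_the_elem_mem by blast
  then have "finite (carrier (G Mod kernel G Q \<phi>))"
    using FactGroup_inj_on assms(3) finite_imageD finite_subset by metis
  then show ?thesis
    by (simp add: finite_index_normal_def normal_kernel FactGroup_def)
qed

lemma
  assumes "finite_index_normal N G"
  shows finite_index_normal_normal: "N \<lhd> G"
    and group_Mod: "group (G Mod N)"
    and finite_carrier_Mod: "finite (carrier (G Mod N))"
    and hom_Mod: "(\<lambda>x. N #>\<^bsub>G\<^esub> x) \<in> hom G (G Mod N)"
proof -
  show *: "N \<lhd> G"
    using assms by (simp add: finite_index_normal_def)
  show "group (G Mod N)" "(\<lambda>x. N #>\<^bsub>G\<^esub> x) \<in> hom G (G Mod N)"
    using * by (rule normal.factorgroup_is_group, rule normal.r_coset_hom_Mod)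
  show "finite (carrier (G Mod N))"
    using assms by (simp add: finite_index_normal_def FactGroup_def)
qed

lemma r_coset_eq_iff:
  fixes G (structure)
  assumes "N \<lhd> G" "x \<in> carrier G" "y \<in> carrier G"
  shows "N #>\<^bsub>G\<^esub> x = N #>\<^bsub>G\<^esub> y \<longleftrightarrow> x \<otimes>\<^bsub>G\<^esub> inv\<^bsub>G\<^esub> y \<in> N"
proof -
  interpret normal N G by fact
  have "N #> x = N #> y \<longleftrightarrow> x \<in> N #> y"
    using assms repr_independence repr_independenceD rcos_self is_subgroup by metis
  then show ?thesis
    using rcos_module[OF is_group assms(3,2)] by simp
qed

section \<open>Cyclic subgroup separability\<close>

lemma (in group) mem_generate_singleton_iff:
  "a \<in> carrier G \<Longrightarrow> g \<in> generate G {a} \<longleftrightarrow> (\<exists>k::int. g = a [^] k)"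
  by (subst generate_pow) (auto)

text \<open>The kernel of a separating homomorphism works for all exponents at once: an element of
  the given form in it would equate the images of \<open>g\<close> and of a power of
  \<open>a\<close>.\<close>

lemma cyclic_subgroup_separable_avoids:
  fixes G (structure)
  assumes "group G" "cyclic_subgroup_separable G" "a \<in> carrier G" "g \<in> carrier G"
    and "\<And>k::int. g \<noteq> a [^]\<^bsub>G\<^esub> k"
  shows "\<exists>N. finite_index_normal N G \<and> (\<forall>k::int. g \<otimes>\<^bsub>G\<^esub> inv\<^bsub>G\<^esub> (a [^]\<^bsub>G\<^esub> k) \<notin> N)"
proof -
  interpret group G by fact
  have "g \<notin> generate G {a}"
    using assms(3,5) by (simp add: mem_generate_singleton_iff)
  then obtain Q :: "nat monoid" and \<phi> where Q: "group Q" "finite (carrier Q)" "\<phi> \<in> hom G Q"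
    and sep: "\<phi> g \<notin> \<phi> ` generate G {a}"
    using assms(2-4) unfolding cyclic_subgroup_separable_def separable_in_def by blast
  interpret group_hom G Q \<phi>
    using Q by (simp add: group_hom_def group_hom_axioms_def is_group)
  have "g \<otimes> inv (a [^] k) \<notin> kernel G Q \<phi>" for k :: int
  proof
    assume "g \<otimes> inv (a [^] k) \<in> kernel G Q \<phi>"
    then have "\<phi> g \<otimes>\<^bsub>Q\<^esub> inv\<^bsub>Q\<^esub> \<phi> (a [^] k) = \<one>\<^bsub>Q\<^esub>"
      using assms(3,4) by (simp add: kernel_def)
    then have "\<phi> g = \<phi> (a [^] k)"
      using H.inv_equality[of "\<phi> g" "inv\<^bsub>Q\<^esub> \<phi> (a [^] k)"] assms(3,4) by simp
    then show False
      using sep group.mem_generate_singleton_iff[OF assms(1,3), of "a [^] k"] by blast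
  qed
  then show ?thesis
    using finite_index_normal_kernel[OF assms(1) Q] by blast
qed

text \<open>The case of the trivial cyclic subgroup: separability implies residual
  finiteness.\<close>

lemma residually_finite_avoids:
  fixes G (structure)
  assumes "group G" "cyclic_subgroup_separable G" "g \<in> carrier G" "g \<noteq> \<one>\<^bsub>G\<^esub>"
  shows "\<exists>N. finite_index_normal N G \<and> g \<notin> N"
proof -
  interpret group G by fact
  show ?thesis
    using cyclic_subgroup_separable_avoids[OF assms(1,2) one_closed assms(3)] assms(3,4) by simp
qed

text \<open>Residual finiteness is applied to the finitely many elements
  \<open>x \<otimes> inv y\<close> with \<open>x \<noteq> y\<close> in \<open>S\<close>.\<close>

lemma finite_index_normal_inj_on:
  fixes G (structure)
  assumes "group G" "cyclic_subgroup_separable G" "finite S" "S \<subseteq> carrier G"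
  shows "\<exists>N. finite_index_normal N G \<and> inj_on (\<lambda>x. N #>\<^bsub>G\<^esub> x) S"
proof -
  interpret group G by fact
  let ?I = "{(x, y) \<in> S \<times> S. x \<noteq> y}"
  have "\<exists>N. finite_index_normal N G \<and> (\<forall>p\<in>?I. N \<inter> {fst p \<otimes> inv (snd p)} = {})"
  proof (rule finite_index_normal_avoids)
    show "finite ?I"
      using finite_subset[of ?I "S \<times> S"] assms(3) by auto
    fix p assume p: "p \<in> ?I"
    then obtain x y where xy: "p = (x, y)" "x \<in> S" "y \<in> S" "x \<noteq> y" by auto
    then have carr: "x \<in> carrier G" "y \<in> carrier G"
      using assms(4) by blast+
    then have "x \<otimes> inv y \<noteq> \<one>"
      using xy(4) inv_equality[of x "inv y"] by (metis inv_closed inv_inv)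
    moreover have "x \<otimes> inv y \<in> carrier G"
      using carr by simp
    ultimately show "\<exists>N. finite_index_normal N G \<and> N \<inter> {fst p \<otimes> inv (snd p)} = {}"
      using residually_finite_avoids[OF assms(1,2)] xy(1) by simp
  qed fact
  then obtain N where N: "finite_index_normal N G"
    "\<forall>p\<in>?I. N \<inter> {fst p \<otimes> inv (snd p)} = {}" by blast
  have "inj_on (\<lambda>x. N #> x) S"
  proof (rule inj_onI, rule ccontr)
    fix x y assume xy: "x \<in> S" "y \<in> S" "N #> x = N #> y" "x \<noteq> y"
    have "x \<in> carrier G" "y \<in> carrier G"
      using xy(1,2) assms(4) by blast+
    then have "x \<otimes> inv y \<in> N"
      using xy(3) r_coset_eq_iff[OF finite_index_normal_normal[OF N(1)]] by simp
    moreover have "(x, y) \<in> ?I" using xy by simp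
    ultimately show False using N(2) by fastforce
  qed
  then show ?thesis using N(1) by blast
qed

text \<open>The identity separates; \<open>separable_in_witness\<close> moves its codomain to
  \<open>nat\<close>.\<close>

lemma finite_imp_cyclic_subgroup_separable:
  fixes G (structure)
  assumes "group G" "finite (carrier G)"
  shows "cyclic_subgroup_separable G"
  unfolding cyclic_subgroup_separable_def separable_in_def
proof (intro ballI)
  fix a g assume a: "a \<in> carrier G" and g: "g \<in> carrier G - generate G {a}"
  interpret group G by fact
  show "\<exists>(Q :: nat monoid) \<phi>. group Q \<and> finite (carrier Q) \<and> \<phi> \<in> hom G Q \<and> \<phi> g \<notin> \<phi> ` generate G {a}"
    by (rule separable_in_witness[OF assms, of id])
      (use a g generate_incl[of "{a}"] in \<open>auto simp: hom_def\<close>)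
qed

text \<open>A single instance of separability, isolated so that it can be transported from one
  element \<open>g\<close> to another.\<close>

definition finitely_separated :: "('a, 'c) monoid_scheme \<Rightarrow> 'a \<Rightarrow> 'a \<Rightarrow> bool" where
  "finitely_separated G a g \<longleftrightarrow>
     (\<exists>(Q :: nat monoid) \<phi>. group Q \<and> finite (carrier Q) \<and> \<phi> \<in> hom G Q \<and> \<phi> g \<notin> \<phi> ` generate G {a})"

lemma cyclic_subgroup_separableI:
  assumes "group G"
    and "\<And>a g. a \<in> carrier G \<Longrightarrow> g \<in> carrier G \<Longrightarrow> (\<And>k::int. g \<noteq> a [^]\<^bsub>G\<^esub> k) \<Longrightarrow> finitely_separated G a g"
  shows "cyclic_subgroup_separable G"
  unfolding cyclic_subgroup_separable_def separable_in_def finitely_separated_def[symmetric]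
  using assms by (auto simp: group.mem_generate_singleton_iff)

text \<open>Separation pulls back along \<open>\<phi>\<close>: the image of a cyclic subgroup is
  cyclic, hence separable in \<open>K\<close>, and homomorphisms compose.\<close>

lemma finitely_separated_hom:
  fixes G (structure)
  assumes "group G" "group K" "cyclic_subgroup_separable K" "\<phi> \<in> hom G K"
    and a: "a \<in> carrier G" and g: "g \<in> carrier G"
    and sep: "\<And>k::int. \<phi> g \<noteq> \<phi> (a [^] k)"
  shows "finitely_separated G a g"
proof -
  interpret group_hom G K \<phi>
    using assms by (simp add: group_hom_def group_hom_axioms_def)
  have img: "\<phi> ` generate G {a} = generate K {\<phi> a}"
    using generate_img[of "{a}"] a by simp
  have "\<phi> g \<notin> generate K {\<phi> a}"
    unfolding img[symmetric] using sep a by (auto simp: G.generate_pow)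
  then obtain Q :: "nat monoid" and \<psi> where Q: "group Q" "finite (carrier Q)" "\<psi> \<in> hom K Q"
    "\<psi> (\<phi> g) \<notin> \<psi> ` generate K {\<phi> a}"
    using assms(3)[unfolded cyclic_subgroup_separable_def separable_in_def, rule_format, of "\<phi> a" "\<phi> g"] a g
    by auto
  have "(\<psi> \<circ> \<phi>) g \<notin> (\<psi> \<circ> \<phi>) ` generate G {a}"
    using Q(4) unfolding image_comp[symmetric] img by simp
  moreover have "\<psi> \<circ> \<phi> \<in> hom G Q"
    using assms(4) Q(3) by (auto simp: hom_def Pi_iff)
  ultimately show ?thesis
    unfolding finitely_separated_def using Q by blast
qed

text \<open>The coset of \<open>g\<close> modulo the cyclic subgroup does not change, so the same
  homomorphism separates.\<close>

lemma finitely_separated_mult_int_pow: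
  fixes G (structure) and i :: int
  assumes "group G" "finitely_separated G a g" "a \<in> carrier G" "g \<in> carrier G"
  shows "finitely_separated G a (g \<otimes> a [^] i)"
proof -
  obtain Q :: "nat monoid" and \<phi> where Q: "group Q" "finite (carrier Q)" "\<phi> \<in> hom G Q"
    and sep: "\<phi> g \<notin> \<phi> ` generate G {a}"
    using assms(2) unfolding finitely_separated_def by blast
  interpret group_hom G Q \<phi>
    using assms(1) Q by (simp add: group_hom_def group_hom_axioms_def)
  have "\<phi> (g \<otimes> a [^] i) \<noteq> \<phi> (a [^] k)" for k :: int
  proof
    assume "\<phi> (g \<otimes> a [^] i) = \<phi> (a [^] k)"
    also have "\<dots> = \<phi> (a [^] (k - i) \<otimes> a [^] i)"
      using assms(3) by (simp flip: G.int_pow_mult)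
    finally have "\<phi> g = \<phi> (a [^] (k - i))"
      using assms(3,4) by simp
    moreover have "a [^] (k - i) \<in> generate G {a}"
      using G.mem_generate_singleton_iff[OF assms(3)] by blast
    ultimately show False using sep by blast
  qed
  then have "\<phi> (g \<otimes> a [^] i) \<notin> \<phi> ` generate G {a}"
    using G.mem_generate_singleton_iff[OF assms(3)] by (metis imageE)
  then show ?thesis
    unfolding finitely_separated_def using Q by blast
qed

text \<open>Separability passes to subgroups, since an embedding keeps \<open>g\<close> off the
  powers of \<open>a\<close>.\<close>

lemma cyclic_subgroup_separable_inj_hom:
  assumes "group G" "group K" "cyclic_subgroup_separable K" "\<phi> \<in> hom G K" "inj_on \<phi> (carrier G)"
  shows "cyclic_subgroup_separable G"
proof (rule cyclic_subgroup_separableI)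
  interpret group G by fact
  fix a g assume ag: "a \<in> carrier G" "g \<in> carrier G" "\<And>k::int. g \<noteq> a [^]\<^bsub>G\<^esub> k"
  then have "\<phi> g \<noteq> \<phi> (a [^]\<^bsub>G\<^esub> k)" for k :: int
    using assms(5) by (simp add: inj_on_eq_iff)
  then show "finitely_separated G a g"
    using finitely_separated_hom assms(1-4) ag(1,2) by metis
qed fact

text \<open>Whether \<open>a [^] i\<close> is a power of \<open>a [^] m\<close> depends only on
  \<open>i\<close> modulo \<open>m\<close>. So it suffices to separate from the powers of
  \<open>a [^] m\<close> those finitely many \<open>a [^] r\<close> with
  \<open>0 \<le> r < m\<close> that are not among them.\<close>

lemma powers_avoid:
  fixes G (structure)
  assumes "group G" "cyclic_subgroup_separable G" "a \<in> carrier G" "(m::int) > 0"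
  shows "\<exists>N. finite_index_normal N G \<and> (\<forall>i::int. a [^]\<^bsub>G\<^esub> i \<in> N \<longrightarrow> (\<exists>q. a [^]\<^bsub>G\<^esub> i = a [^]\<^bsub>G\<^esub> (m * q)))"
proof -
  interpret group G by fact
  let ?I = "{r \<in> {0..<m}. \<forall>q. a [^] r \<noteq> a [^] (m * q)}"
  have fin: "finite ?I"
    by (rule finite_subset[of _ "{0..<m}"]) auto
  have "\<exists>N. finite_index_normal N G \<and> (\<forall>r\<in>?I. N \<inter> range (\<lambda>q. a [^] (r - m * q)) = {})"
  proof (rule finite_index_normal_avoids)
    fix r assume "r \<in> ?I"
    then have "\<exists>N. finite_index_normal N G \<and> (\<forall>q::int. a [^] r \<otimes> inv ((a [^] m) [^] q) \<notin> N)"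
      by (intro cyclic_subgroup_separable_avoids) (use assms in \<open>auto simp: int_pow_pow\<close>)
    then show "\<exists>N. finite_index_normal N G \<and> N \<inter> range (\<lambda>q. a [^] (r - m * q)) = {}"
      using assms(3) by (auto simp: int_pow_pow int_pow_diff disjoint_iff)
  qed (use assms(1) fin in auto)
  then obtain N where N: "finite_index_normal N G"
    "\<forall>r\<in>?I. N \<inter> range (\<lambda>q. a [^] (r - m * q)) = {}" by blast
  have "\<exists>q. a [^] i = a [^] (m * q)" if i: "a [^] i \<in> N" for i :: int
  proof -
    \<comment> \<open>This brings \<open>a [^] i\<close> into the form
      \<open>a [^] (r - m * q)\<close>, which \<open>N\<close> avoids for every bad residue
      \<open>r\<close>.\<close>
    have i': "i = i mod m - m * (- (i div m))" by (simp add: algebra_simps)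
    then have "i mod m \<notin> ?I"
      using N(2) i by (metis (no_types, lifting) disjoint_iff rangeI)
    then obtain q where "a [^] (i mod m) = a [^] (m * q)"
      using assms(4) by auto
    then have "a [^] i = a [^] (m * (q + i div m))"
      using i' assms(3) by (metis (no_types, opaque_lifting) diff_minus_eq_add distrib_left int_pow_mult mult_minus_right)
    then show ?thesis by blast
  qed
  then show ?thesis using N(1) by blast
qed

text \<open>This separates the tuple \<open>v\<close> from the powers of the tuple \<open>u\<close>
  in a finite power of \<open>G\<close>. If some \<open>v x\<close> is no power of
  \<open>u x\<close>, that coordinate suffices. Otherwise \<open>v x = u x [^] k x\<close>, and the
  congruences \<open>j \<equiv> k x\<close> modulo the orders of the \<open>u x\<close> have no
  common solution \<open>j\<close>; they stay unsolvable modulo a suitable \<open>m\<close>, which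
  \<open>powers_avoid\<close> carries into a quotient.\<close>

lemma simultaneous_powers_avoid:
  fixes G (structure)
  assumes "group G" "cyclic_subgroup_separable G" "finite I"
    and u: "\<And>x. x \<in> I \<Longrightarrow> u x \<in> carrier G" and v: "\<And>x. x \<in> I \<Longrightarrow> v x \<in> carrier G"
    and neq: "\<And>j::int. \<exists>x\<in>I. v x \<noteq> u x [^]\<^bsub>G\<^esub> j"
  shows "\<exists>N. finite_index_normal N G \<and>
    (\<forall>j::int. \<exists>x\<in>I. N #>\<^bsub>G\<^esub> v x \<noteq> N #>\<^bsub>G\<^esub> (u x [^]\<^bsub>G\<^esub> j))"
proof (cases "\<exists>x\<in>I. \<forall>k::int. v x \<noteq> u x [^]\<^bsub>G\<^esub> k")
  case True
  interpret group G by fact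
  from True obtain x where x: "x \<in> I" "\<forall>k::int. v x \<noteq> u x [^] k" by blast
  then obtain N where N: "finite_index_normal N G" "\<forall>k::int. v x \<otimes> inv (u x [^] k) \<notin> N"
    using cyclic_subgroup_separable_avoids[OF assms(1,2) u v] by blast
  then show ?thesis
    using x(1) u v by (metis finite_index_normal_normal int_pow_closed r_coset_eq_iff)
next
  case False
  interpret group G by fact
  from False obtain k :: "_ \<Rightarrow> int" where k: "\<And>x. x \<in> I \<Longrightarrow> v x = u x [^] k x" by metis
  \<comment> \<open>The modulus replaces infinite orders, so that a congruence modulo it decides the exponent.\<close>
  have "\<exists>m::int>0. \<forall>j. \<exists>x\<in>I. \<forall>q. u x [^] (j - k x) \<noteq> u x [^] (m * q)"
  proof (cases "\<forall>x\<in>I. ord (u x) > 0")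
    case True
    \<comment> \<open>All orders divide this \<open>m\<close>, so \<open>u x [^] (m * q)\<close> is
      trivial and nothing is lost by working modulo \<open>m\<close>.\<close>
    define m where "m = int (\<Prod>x\<in>I. ord (u x))"
    have "m > 0" using True by (auto simp: m_def intro!: prod_pos)
    moreover have "v x = u x [^] j" if "x \<in> I" "u x [^] (j - k x) = u x [^] (m * q)" for x j q
    proof -
      have "int (ord (u x)) dvd m * q"
        unfolding m_def using dvd_prodI[OF assms(3) that(1), of "\<lambda>x. ord (u x)"]
        by (intro dvd_mult2) (simp del: of_nat_prod)
      then have "u x [^] (j - k x) = \<one>"
        using that u by (simp add: int_pow_eq_id)
      then show ?thesis
        using that(1) u k by (simp add: int_pow_eq_id int_pow_eq)
    qed
    ultimately show ?thesis using neq by metis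
  next
    case False
    then obtain x where x: "x \<in> I" "ord (u x) = 0" by auto
    \<comment> \<open>Infinite order at \<open>x\<close> leaves \<open>j = k x\<close> as the only
      candidate, and \<open>y\<close> is a coordinate refuting it.\<close>
    obtain y where y: "y \<in> I" "v y \<noteq> u y [^] k x" using neq by blast
    \<comment> \<open>The coordinate \<open>x\<close> forces \<open>j \<equiv> k x\<close> modulo
      \<open>m\<close>. With this \<open>m\<close>, the coordinate \<open>y\<close> then forces
      \<open>k x \<equiv> k y\<close> modulo the order of \<open>u y\<close>, or
      \<open>k x = k y\<close> if that order is infinite, because \<open>m\<close> exceeds their
      distance. Both contradict the choice of \<open>y\<close>.\<close>
    define m where "m = (if ord (u y) > 0 then int (ord (u y)) else \<bar>k x - k y\<bar> + 1)"
    have "m > 0" by (auto simp: m_def)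
    moreover have False if "u x [^] (j - k x) = u x [^] (m * q)" "u y [^] (j - k y) = u y [^] (m * r)" for j q r
    proof -
      have 1: "k x - k y = m * (r - q) - (m * r - (j - k y))"
        using that(1) x u by (simp add: int_pow_eq algebra_simps)
      have 2: "int (ord (u y)) dvd m * r - (j - k y)"
        using that(2) y u by (simp add: int_pow_eq)
      have 3: "\<not> int (ord (u y)) dvd k x - k y"
        using y u k by (simp add: int_pow_eq)
      show False
      proof (cases "ord (u y) = 0")
        case True
        then have "m dvd \<bar>k x - k y\<bar>" using 1 2 by simp
        moreover have "\<bar>k x - k y\<bar> > 0" "m > \<bar>k x - k y\<bar>"
          using 3 True by (auto simp: m_def)
        ultimately show False using zdvd_imp_le[of m "\<bar>k x - k y\<bar>"] by linarith
      next
        case False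
        then have "int (ord (u y)) dvd m * (r - q)" by (simp add: m_def)
        then show False using 1 2 3 by (metis dvd_diff)
      qed
    qed
    ultimately show ?thesis using x(1) y(1) by metis
  qed
  then obtain m :: int where m: "m > 0"
    "\<And>j. \<exists>x\<in>I. \<forall>q. u x [^] (j - k x) \<noteq> u x [^] (m * q)" by blast
  have "\<exists>N. finite_index_normal N G \<and>
      (\<forall>x\<in>I. N \<inter> {u x [^] i |i::int. \<forall>q. u x [^] i \<noteq> u x [^] (m * q)} = {})"
  proof (rule finite_index_normal_avoids)
    fix x assume "x \<in> I"
    then show "\<exists>N. finite_index_normal N G \<and> N \<inter> {u x [^] i |i::int. \<forall>q. u x [^] i \<noteq> u x [^] (m * q)} = {}"
      using powers_avoid[OF assms(1,2) u m(1)] by blast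
  qed fact+
  then obtain N where N: "finite_index_normal N G"
    "\<And>x i. x \<in> I \<Longrightarrow> u x [^] (i::int) \<in> N \<Longrightarrow> \<exists>q. u x [^] i = u x [^] (m * q)" by blast
  have "\<exists>x\<in>I. N #> v x \<noteq> N #> (u x [^] j)" for j :: int
  proof (rule ccontr)
    assume "\<not> ?thesis"
    then have "N #> (u x [^] j) = N #> (u x [^] k x)" if "x \<in> I" for x
      using that k by simp
    then have "u x [^] (j - k x) \<in> N" if "x \<in> I" for x
      using that u by (simp add: r_coset_eq_iff[OF finite_index_normal_normal[OF N(1)]] int_pow_diff)
    then show False using N(2) m(2) by metis
  qed
  then show ?thesis using N(1) by blast
qed


section \<open>Wreath products\<close>

locale wreath = G: group G + H: group H
  for G :: "('g, 'c) monoid_scheme" and H :: "('h, 'd) monoid_scheme"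
begin

abbreviation W where "W \<equiv> wreath_product G H"
abbreviation B where "B \<equiv> sum_group (carrier H) (\<lambda>_. G)"

sublocale W: group W
  by (rule group_wreath_product) unfold_locales

sublocale B: group B
  by simp

lemma carrier_B: "carrier B = {f \<in> carrier H \<rightarrow>\<^sub>E carrier G. finite {x \<in> carrier H. f x \<noteq> \<one>\<^bsub>G\<^esub>}}"
  by (simp add: carrier_sum_group)

lemma B_apply_closed: "f \<in> carrier B \<Longrightarrow> x \<in> carrier H \<Longrightarrow> f x \<in> carrier G"
  by (auto simp: carrier_B)

lemma finite_support: "f \<in> carrier B \<Longrightarrow> finite {x \<in> carrier H. f x \<noteq> \<one>\<^bsub>G\<^esub>}"
  by (simp add: carrier_B)

lemma B_eqI:
  assumes "f \<in> carrier B" "g \<in> carrier B" "\<And>x. x \<in> carrier H \<Longrightarrow> f x = g x"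
  shows "f = g"
  using assms by (auto simp: carrier_B intro: PiE_ext)

lemma carrier_W: "carrier W = carrier B \<times> carrier H"
  by (simp add: wreath_product_def semidirect_product_def)

lemma mult_W: "(f, h) \<otimes>\<^bsub>W\<^esub> (f', h') = (f \<otimes>\<^bsub>B\<^esub> regular_shift H h f', h \<otimes>\<^bsub>H\<^esub> h')"
  by (simp add: wreath_product_def semidirect_product_def)

lemma one_W: "\<one>\<^bsub>W\<^esub> = (\<one>\<^bsub>B\<^esub>, \<one>\<^bsub>H\<^esub>)"
  by (simp add: wreath_product_def semidirect_product_def)

text \<open>Read off from closure of \<open>W\<close>: the shift of \<open>f\<close> is the base
  component of a product of an element of the top group with one of the base group.\<close>

lemma shift_closed:
  assumes "h \<in> carrier H" "f \<in> carrier B"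
  shows "regular_shift H h f \<in> carrier B"
proof -
  have "(\<one>\<^bsub>B\<^esub>, h) \<otimes>\<^bsub>W\<^esub> (f, \<one>\<^bsub>H\<^esub>) \<in> carrier W"
    using assms by (intro W.m_closed) (auto simp: carrier_W simp del: one_sum_group)
  then have "\<one>\<^bsub>B\<^esub> \<otimes>\<^bsub>B\<^esub> regular_shift H h f \<in> carrier B"
    by (simp add: mult_W carrier_W del: one_sum_group mult_sum_group)
  also have "\<one>\<^bsub>B\<^esub> \<otimes>\<^bsub>B\<^esub> regular_shift H h f = regular_shift H h f"
    using assms by (auto simp: regular_shift_def fun_eq_iff B_apply_closed)
  finally show ?thesis .
qed

lemma shift_one: "f \<in> carrier B \<Longrightarrow> regular_shift H \<one>\<^bsub>H\<^esub> f = f"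
  by (auto simp: regular_shift_def carrier_B PiE_iff extensional_def)

lemma snd_hom: "snd \<in> hom W H"
  by (auto simp: hom_def carrier_W mult_W)

lemma base_hom: "(\<lambda>f. (f, \<one>\<^bsub>H\<^esub>)) \<in> hom B W"
  by (auto simp: hom_def carrier_W mult_W shift_one simp del: mult_sum_group)

lemma base_int_pow: "f \<in> carrier B \<Longrightarrow> (f, \<one>\<^bsub>H\<^esub>) [^]\<^bsub>W\<^esub> (k::int) = (f [^]\<^bsub>B\<^esub> k, \<one>\<^bsub>H\<^esub>)"
  using hom_int_pow[OF base_hom] B.is_group W.is_group by metis

lemma snd_int_pow: "w \<in> carrier W \<Longrightarrow> snd (w [^]\<^bsub>W\<^esub> (k::int)) = snd w [^]\<^bsub>H\<^esub> k"
  using hom_int_pow[OF snd_hom] W.is_group H.is_group by metis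

lemma B_int_pow_apply:
  assumes "f \<in> carrier B" "x \<in> carrier H"
  shows "(f [^]\<^bsub>B\<^esub> (k::int)) x = f x [^]\<^bsub>G\<^esub> k"
proof -
  have "(\<lambda>f. f x) \<in> hom B G"
    using assms(2) by (auto simp: hom_def B_apply_closed)
  then show ?thesis
    using hom_int_pow[of "\<lambda>f. f x" B G] assms(1) B.is_group G.is_group by metis
qed

text \<open>Raising \<open>w\<close> to the order of its top component lands in the base group. For
  infinite order \<open>ord\<close> is 0, and \<open>F\<close> is trivial.\<close>

lemma W_int_pow_ord:
  assumes "w \<in> carrier W"
  obtains F where "F \<in> carrier B"
    "\<And>q. w [^]\<^bsub>W\<^esub> (int (H.ord (snd w)) * q) = (F [^]\<^bsub>B\<^esub> q, \<one>\<^bsub>H\<^esub>)"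
proof -
  define n where "n = int (H.ord (snd w))"
  define F where "F = fst (w [^]\<^bsub>W\<^esub> n)"
  have wn: "w [^]\<^bsub>W\<^esub> n \<in> carrier W" using assms by simp
  then have F: "F \<in> carrier B" by (auto simp: F_def carrier_W)
  have "snd w \<in> carrier H"
    using assms by (auto simp: carrier_W)
  then have "snd (w [^]\<^bsub>W\<^esub> n) = \<one>\<^bsub>H\<^esub>"
    using assms by (simp add: snd_int_pow n_def H.int_pow_eq_id)
  then have "w [^]\<^bsub>W\<^esub> n = (F, \<one>\<^bsub>H\<^esub>)"
    by (simp add: F_def prod_eq_iff)
  then have "w [^]\<^bsub>W\<^esub> (n * q) = (F [^]\<^bsub>B\<^esub> q, \<one>\<^bsub>H\<^esub>)" for q
    using assms F base_int_pow by (metis W.int_pow_pow)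
  then show ?thesis using that F by (simp add: n_def)
qed

text \<open>If the top component of \<open>g\<close> is not a power of that of \<open>w\<close>, the
  projection to \<open>H\<close> separates. Otherwise a power of \<open>w\<close> moves
  \<open>g\<close> into the base group without changing its coset.\<close>

lemma wreath_separable_if_base_separated:
  assumes "cyclic_subgroup_separable H"
    and sep: "\<And>w f. w \<in> carrier W \<Longrightarrow> f \<in> carrier B \<Longrightarrow> (\<And>k::int. (f, \<one>\<^bsub>H\<^esub>) \<noteq> w [^]\<^bsub>W\<^esub> k) \<Longrightarrow>
      finitely_separated W w (f, \<one>\<^bsub>H\<^esub>)"
  shows "cyclic_subgroup_separable W"
proof (rule cyclic_subgroup_separableI)
  show "group W" by (rule W.is_group)
  fix w g assume w: "w \<in> carrier W" and g: "g \<in> carrier W" and neq: "\<And>k::int. g \<noteq> w [^]\<^bsub>W\<^esub> k"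
  show "finitely_separated W w g"
  proof (cases "\<exists>i::int. snd g = snd w [^]\<^bsub>H\<^esub> i")
    case True
    then obtain i :: int where i: "snd g = snd w [^]\<^bsub>H\<^esub> i" by blast
    define u where "u = g \<otimes>\<^bsub>W\<^esub> w [^]\<^bsub>W\<^esub> (- i)"
    have u: "u \<in> carrier W" using w g by (simp add: u_def)
    have gu: "g = u \<otimes>\<^bsub>W\<^esub> w [^]\<^bsub>W\<^esub> i"
      using w g by (simp add: u_def W.m_assoc W.int_pow_neg)
    have sw: "snd w \<in> carrier H" using w by (auto simp: carrier_W)
    have "snd u = snd g \<otimes>\<^bsub>H\<^esub> snd (w [^]\<^bsub>W\<^esub> (- i))"
      unfolding u_def using w g by (intro hom_mult[OF snd_hom]) auto
    also have "\<dots> = \<one>\<^bsub>H\<^esub>"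
      using sw w by (simp add: snd_int_pow i H.int_pow_neg)
    finally have u_eq: "u = (fst u, \<one>\<^bsub>H\<^esub>)" by (simp add: prod_eq_iff)
    have "u \<noteq> w [^]\<^bsub>W\<^esub> k" for k :: int
      using neq[of "k + i"] gu w by (auto simp: W.int_pow_mult)
    then have "finitely_separated W w u"
      using sep[of w "fst u"] w u u_eq by (metis SigmaE carrier_W fst_conv)
    then show ?thesis
      using finitely_separated_mult_int_pow[OF W.is_group _ w u] gu by metis
  next
    case False
    then have "snd g \<noteq> snd (w [^]\<^bsub>W\<^esub> k)" for k :: int
      using w by (simp add: snd_int_pow)
    then show ?thesis
      by (intro finitely_separated_hom[OF W.is_group H.is_group assms(1) snd_hom w g])
  qed
qed

section \<open>The embedded copies of \<open>G\<close> and \<open>H\<close>, and commutativity of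
  \<open>G\<close> for infinite \<open>H\<close>\<close>

definition single :: "'h \<Rightarrow> 'g \<Rightarrow> ('h \<Rightarrow> 'g) \<times> 'h" where
  "single y a = ((\<lambda>x\<in>carrier H. if x = y then a else \<one>\<^bsub>G\<^esub>), \<one>\<^bsub>H\<^esub>)"

definition top :: "'h \<Rightarrow> ('h \<Rightarrow> 'g) \<times> 'h" where
  "top h = (\<one>\<^bsub>B\<^esub>, h)"

lemma single_base_closed:
  assumes "a \<in> carrier G"
  shows "(\<lambda>x\<in>carrier H. if x = y then a else \<one>\<^bsub>G\<^esub>) \<in> carrier B"
proof -
  have "{x \<in> carrier H. (\<lambda>x\<in>carrier H. if x = y then a else \<one>\<^bsub>G\<^esub>) x \<noteq> \<one>\<^bsub>G\<^esub>} \<subseteq> {y}" by auto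
  then have "finite {x \<in> carrier H. (\<lambda>x\<in>carrier H. if x = y then a else \<one>\<^bsub>G\<^esub>) x \<noteq> \<one>\<^bsub>G\<^esub>}"
    using finite_subset by blast
  then show ?thesis using assms by (auto simp: carrier_B)
qed

lemma single_closed: "a \<in> carrier G \<Longrightarrow> single y a \<in> carrier W"
  by (simp add: single_def carrier_W single_base_closed)

lemma single_mult:
  assumes "a \<in> carrier G" "b \<in> carrier G"
  shows "single y a \<otimes>\<^bsub>W\<^esub> single y b = single y (a \<otimes>\<^bsub>G\<^esub> b)"
  using assms by (auto simp: single_def mult_W shift_one single_base_closed)

lemma single_hom: "single y \<in> hom G W"
  by (auto simp: hom_def single_closed single_mult)

lemma single_inj:
  assumes "y \<in> carrier H"
  shows "inj_on (single y) (carrier G)"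
proof (rule inj_onI)
  fix a b assume "single y a = single y b"
  then have "fst (single y a) y = fst (single y b) y" by simp
  then show "a = b" using assms by (simp add: single_def)
qed

lemma single_commute:
  assumes "y \<noteq> z" "a \<in> carrier G" "b \<in> carrier G"
  shows "single y a \<otimes>\<^bsub>W\<^esub> single z b = single z b \<otimes>\<^bsub>W\<^esub> single y a"
  using assms by (auto simp: single_def mult_W shift_one single_base_closed)

lemma top_hom: "top \<in> hom H W"
proof (rule homI)
  fix h k assume "h \<in> carrier H" "k \<in> carrier H"
  then show "top (h \<otimes>\<^bsub>H\<^esub> k) = top h \<otimes>\<^bsub>W\<^esub> top k"
    by (auto simp: top_def mult_W regular_shift_def)
qed (simp add: top_def carrier_W del: one_sum_group)

lemma top_inj: "inj_on top A"
  by (auto simp: top_def inj_on_def)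

text \<open>Conjugation by \<open>top h\<close> carries the copy of \<open>G\<close> at the identity
  to the copy at \<open>h\<close>. Stated without inverses, it passes directly to quotients.\<close>

lemma top_single:
  assumes "h \<in> carrier H" "a \<in> carrier G"
  shows "top h \<otimes>\<^bsub>W\<^esub> single \<one>\<^bsub>H\<^esub> a = single h a \<otimes>\<^bsub>W\<^esub> top h"
proof -
  have "inv\<^bsub>H\<^esub> h \<otimes>\<^bsub>H\<^esub> x = \<one>\<^bsub>H\<^esub> \<longleftrightarrow> x = h" if "x \<in> carrier H" for x
    using assms that H.inv_solve_left[of "\<one>\<^bsub>H\<^esub>" h x] by (simp add: eq_commute[of "\<one>\<^bsub>H\<^esub>"])
  then show ?thesis
    using assms by (auto simp: top_def single_def mult_W regular_shift_def fun_eq_iff)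
qed

lemma comm_if_separable:
  assumes "cyclic_subgroup_separable W" "infinite (carrier H)"
  shows "comm_group G"
proof (rule G.group_comm_groupI, rule ccontr)
  fix a b assume ab: "a \<in> carrier G" "b \<in> carrier G" "a \<otimes>\<^bsub>G\<^esub> b \<noteq> b \<otimes>\<^bsub>G\<^esub> a"
  \<comment> \<open>Residual finiteness keeps the two products distinct in a finite quotient; the
    contradiction is that they become equal there.\<close>
  let ?S = "single \<one>\<^bsub>H\<^esub> ` {a \<otimes>\<^bsub>G\<^esub> b, b \<otimes>\<^bsub>G\<^esub> a}"
  obtain N where N: "finite_index_normal N W" and inj: "inj_on (\<lambda>x. N #>\<^bsub>W\<^esub> x) ?S"
    using finite_index_normal_inj_on[OF W.is_group assms(1), of ?S] ab single_closed by auto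
  define \<theta> where "\<theta> x = N #>\<^bsub>W\<^esub> x" for x
  interpret \<theta>: group_hom W "W Mod N" \<theta>
    using hom_Mod[OF N] group_Mod[OF N] W.is_group
    by (simp add: group_hom_def group_hom_axioms_def \<theta>_def[abs_def])
  have top: "top h \<in> carrier W" if "h \<in> carrier H" for h
    using top_hom that by (auto simp: hom_def)
  have "(\<lambda>h. \<theta> (top h)) ` carrier H \<subseteq> carrier (W Mod N)"
    using top \<theta>.hom_closed by blast
  \<comment> \<open>Pigeonhole: the infinite group \<open>H\<close> is mapped to a finite
    one.\<close>
  then have "\<not> inj_on (\<lambda>h. \<theta> (top h)) (carrier H)"
    using finite_carrier_Mod[OF N] assms(2) inj_on_finite by blast
  then obtain h k where hk: "h \<in> carrier H" "k \<in> carrier H" "h \<noteq> k" "\<theta> (top h) = \<theta> (top k)"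
    by (auto simp: inj_on_def)
  have conj: "\<theta> (top l) \<otimes>\<^bsub>W Mod N\<^esub> \<theta> (single \<one>\<^bsub>H\<^esub> c) = \<theta> (single l c) \<otimes>\<^bsub>W Mod N\<^esub> \<theta> (top l)"
    if "l \<in> carrier H" "c \<in> carrier G" for l c
    using that top single_closed by (metis \<theta>.hom_mult top_single)
  \<comment> \<open>Conjugation by the common image of \<open>top h\<close> and \<open>top k\<close>
    yields both sides from the same element.\<close>
  have eq: "\<theta> (single h c) = \<theta> (single k c)" if "c \<in> carrier G" for c
    using conj[OF hk(1) that] conj[OF hk(2) that] hk that top single_closed
    by (metis \<theta>.H.r_cancel \<theta>.hom_closed)
  have "\<theta> (single h (a \<otimes>\<^bsub>G\<^esub> b)) = \<theta> (single h a) \<otimes>\<^bsub>W Mod N\<^esub> \<theta> (single k b)"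
    using ab single_closed by (simp add: eq flip: single_mult)
  also have "\<dots> = \<theta> (single h a \<otimes>\<^bsub>W\<^esub> single k b)"
    using ab single_closed by simp
  also have "\<dots> = \<theta> (single k b \<otimes>\<^bsub>W\<^esub> single h a)"
    using single_commute[OF hk(3) ab(1,2)] by simp
  also have "\<dots> = \<theta> (single h b) \<otimes>\<^bsub>W Mod N\<^esub> \<theta> (single h a)"
    using ab single_closed by (simp add: eq)
  also have "\<dots> = \<theta> (single h (b \<otimes>\<^bsub>G\<^esub> a))"
    using ab single_closed by (simp flip: single_mult)
  finally have "\<theta> (single h (a \<otimes>\<^bsub>G\<^esub> b)) = \<theta> (single h (b \<otimes>\<^bsub>G\<^esub> a))" .
  \<comment> \<open>Undoing the conjugation by \<open>top h\<close> returns to the coordinate where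
    the products were kept apart.\<close>
  then have "\<theta> (single \<one>\<^bsub>H\<^esub> (a \<otimes>\<^bsub>G\<^esub> b)) = \<theta> (single \<one>\<^bsub>H\<^esub> (b \<otimes>\<^bsub>G\<^esub> a))"
    using conj[OF hk(1)] ab hk(1) top single_closed
    by (metis G.m_closed \<theta>.H.l_cancel \<theta>.hom_closed)
  then have "single \<one>\<^bsub>H\<^esub> (a \<otimes>\<^bsub>G\<^esub> b) = single \<one>\<^bsub>H\<^esub> (b \<otimes>\<^bsub>G\<^esub> a)"
    unfolding \<theta>_def by (rule inj_onD[OF inj]) auto
  then show False
    using ab inj_onD[OF single_inj[of "\<one>\<^bsub>H\<^esub>"]] by auto
qed

section \<open>Finite top group\<close>

lemma hom_map_base:
  assumes "group Q" "\<psi> \<in> hom G Q"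
  shows "(\<lambda>(f, h). (\<lambda>x\<in>carrier H. \<psi> (f x), h)) \<in> hom W (wreath_product Q H)"
proof -
  interpret Q: wreath Q H
    using assms(1) by (simp add: wreath_def H.is_group)
  interpret \<psi>: group_hom G Q \<psi>
    using assms by (simp add: group_hom_def group_hom_axioms_def G.is_group)
  have "(\<lambda>x\<in>carrier H. \<psi> (f x)) \<in> carrier Q.B" if f: "f \<in> carrier B" for f
  proof -
    have "finite {x \<in> carrier H. \<psi> (f x) \<noteq> \<one>\<^bsub>Q\<^esub>}"
      by (rule finite_subset[OF _ finite_support[OF f]]) auto
    then show ?thesis
      using f by (auto simp: Q.carrier_B B_apply_closed cong: conj_cong)
  qed
  then show ?thesis
    by (auto simp: hom_def carrier_W Q.carrier_W mult_W Q.mult_W regular_shift_def B_apply_closed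
        intro!: restrict_ext)
qed

text \<open>The finite group that separates is the wreath product of a finite quotient of
  \<open>G\<close> with \<open>H\<close>. Its top group is still \<open>H\<close>, so only the
  powers of \<open>w\<close> in the base group, the powers of \<open>F\<close>, can collide with
  \<open>f\<close>.\<close>

lemma separable_finite_top:
  assumes "cyclic_subgroup_separable G" "finite (carrier H)"
  shows "cyclic_subgroup_separable W"
proof (rule wreath_separable_if_base_separated)
  show "cyclic_subgroup_separable H"
    using finite_imp_cyclic_subgroup_separable H.is_group assms(2) .
  fix w f assume w: "w \<in> carrier W" and f: "f \<in> carrier B"
    and neq: "\<And>k::int. (f, \<one>\<^bsub>H\<^esub>) \<noteq> w [^]\<^bsub>W\<^esub> k"
  define n where "n = int (H.ord (snd w))"
  have sw: "snd w \<in> carrier H" using w by (auto simp: carrier_W)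
  obtain F where F: "F \<in> carrier B" "\<And>q. w [^]\<^bsub>W\<^esub> (n * q) = (F [^]\<^bsub>B\<^esub> q, \<one>\<^bsub>H\<^esub>)"
    using W_int_pow_ord[OF w] n_def by metis
  \<comment> \<open>The coordinate may vary with \<open>q\<close>, whence the simultaneous version
    for tuples.\<close>
  have "\<exists>x\<in>carrier H. f x \<noteq> F x [^]\<^bsub>G\<^esub> q" for q :: int
    using B_eqI[OF f, of "F [^]\<^bsub>B\<^esub> q"] F neq[of "n * q"] by (auto simp: B_int_pow_apply)
  then obtain N where N: "finite_index_normal N G"
    and sep: "\<And>q::int. \<exists>x\<in>carrier H. N #>\<^bsub>G\<^esub> f x \<noteq> N #>\<^bsub>G\<^esub> (F x [^]\<^bsub>G\<^esub> q)"
    using simultaneous_powers_avoid[OF G.is_group assms, of F f] f F B_apply_closed by metis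
  interpret Q: wreath "G Mod N" H
    using group_Mod[OF N] by (simp add: wreath_def H.is_group)
  let ?\<phi> = "\<lambda>(f, h). (\<lambda>x\<in>carrier H. N #>\<^bsub>G\<^esub> f x, h)"
  have "carrier Q.W \<subseteq> (carrier H \<rightarrow>\<^sub>E carrier (G Mod N)) \<times> carrier H"
    by (auto simp: Q.carrier_W Q.carrier_B)
  then have "finite (carrier Q.W)"
    using finite_carrier_Mod[OF N] assms(2) by (meson finite_PiE finite_SigmaI finite_subset)
  moreover have "?\<phi> (f, \<one>\<^bsub>H\<^esub>) \<noteq> ?\<phi> (w [^]\<^bsub>W\<^esub> k)" for k :: int
  proof
    assume eq: "?\<phi> (f, \<one>\<^bsub>H\<^esub>) = ?\<phi> (w [^]\<^bsub>W\<^esub> k)"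
    then have "\<one>\<^bsub>H\<^esub> = snd (w [^]\<^bsub>W\<^esub> k)"
      by (simp add: case_prod_beta)
    then have "n dvd k"
      using w sw by (simp add: snd_int_pow n_def flip: H.int_pow_eq_id)
    then obtain q where k: "k = n * q" ..
    have "N #>\<^bsub>G\<^esub> f x = N #>\<^bsub>G\<^esub> (F x [^]\<^bsub>G\<^esub> q)" if "x \<in> carrier H" for x
    proof -
      have "fst (?\<phi> (f, \<one>\<^bsub>H\<^esub>)) x = fst (?\<phi> (w [^]\<^bsub>W\<^esub> k)) x"
        by (simp only: eq)
      then show ?thesis
        using that F by (simp add: k B_int_pow_apply)
    qed
    then show False
      using sep[of q] by blast
  qed
  ultimately show "finitely_separated W w (f, \<one>\<^bsub>H\<^esub>)"
    using f w hom_map_base[OF group_Mod[OF N] hom_Mod[OF N]] Q.W.is_group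
    by (intro finitely_separated_hom[OF W.is_group, where K = Q.W and \<phi> = ?\<phi>]
        finite_imp_cyclic_subgroup_separable) (auto simp: carrier_W)
qed

end


section \<open>Multiplying entries over the fibres of a homomorphism\<close>

lemma (in comm_monoid) gfinprod_reindex:
  assumes "bij_betw h A A'" "f \<in> A' \<rightarrow> carrier G"
  shows "gfinprod G (\<lambda>x. f (h x)) A = gfinprod G f A'"
proof -
  have A': "A' = h ` A" and inj: "inj_on h A"
    using assms(1) by (auto simp: bij_betw_def)
  \<comment> \<open>\<open>gfinprod\<close> is a \<open>finprod\<close> over the support and
    defaults to one if that is infinite; the bijection matches the two supports.\<close>
  have img: "{y \<in> A'. f y \<noteq> \<one>} = h ` {x \<in> A. f (h x) \<noteq> \<one>}"
    by (auto simp: A')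
  have inj': "inj_on h {x \<in> A. f (h x) \<noteq> \<one>}"
    using inj by (rule inj_on_subset) auto
  have "finprod G f (h ` {x \<in> A. f (h x) \<noteq> \<one>}) = finprod G (\<lambda>x. f (h x)) {x \<in> A. f (h x) \<noteq> \<one>}"
    using assms(2) inj' by (intro finprod_reindex) (auto simp: A')
  then show ?thesis
    unfolding gfinprod_def img by (simp add: finite_image_iff[OF inj'])
qed

text \<open>The pushforward of \<open>f\<close> along \<open>\<pi>\<close>. Fibres may be infinite,
  so \<open>gfinprod\<close> is used, which looks only at the support.\<close>

definition fibre_prod ::
  "('g, 'c) monoid_scheme \<Rightarrow> ('h, 'd) monoid_scheme \<Rightarrow> ('k, 'e) monoid_scheme \<Rightarrow>
    ('h \<Rightarrow> 'k) \<Rightarrow> ('h \<Rightarrow> 'g) \<Rightarrow> 'k \<Rightarrow> 'g" where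
  "fibre_prod G H K \<pi> f = (\<lambda>k\<in>carrier K. gfinprod G f {x \<in> carrier H. \<pi> x = k})"

locale wreath_quotient = wreath G H + G: comm_group G + \<pi>: group_hom H K \<pi>
  for G :: "('g, 'c) monoid_scheme" and H :: "('h, 'd) monoid_scheme"
    and K :: "('k, 'e) monoid_scheme" and \<pi> :: "'h \<Rightarrow> 'k"
begin

sublocale K: wreath G K
  by unfold_locales

abbreviation push where "push \<equiv> fibre_prod G H K \<pi>"

lemma B_restrict: "f \<in> carrier B \<Longrightarrow> f \<in> {x \<in> carrier H. \<pi> x = k} \<rightarrow> carrier G"
  by (auto simp: B_apply_closed)

lemma finite_support_fibre:
  "f \<in> carrier B \<Longrightarrow> finite {x \<in> {x \<in> carrier H. \<pi> x = k}. f x \<noteq> \<one>\<^bsub>G\<^esub>}"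
  by (rule finite_subset[OF _ finite_support]) auto

text \<open>A nontrivial product needs a nontrivial factor, so the new support lies in the image of
  the old one.\<close>

lemma push_closed:
  assumes "f \<in> carrier B"
  shows "push f \<in> carrier K.B"
proof -
  have "{k \<in> carrier K. push f k \<noteq> \<one>\<^bsub>G\<^esub>} \<subseteq> \<pi> ` {x \<in> carrier H. f x \<noteq> \<one>\<^bsub>G\<^esub>}"
  proof
    fix k assume "k \<in> {k \<in> carrier K. push f k \<noteq> \<one>\<^bsub>G\<^esub>}"
    then have "gfinprod G f {x \<in> carrier H. \<pi> x = k} \<noteq> \<one>\<^bsub>G\<^esub>"
      by (auto simp: fibre_prod_def)
    moreover have "gfinprod G f A = \<one>\<^bsub>G\<^esub>" if "{x \<in> A. f x \<noteq> \<one>\<^bsub>G\<^esub>} = {}" for A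
      unfolding gfinprod_def that by simp
    ultimately have "{x \<in> {x \<in> carrier H. \<pi> x = k}. f x \<noteq> \<one>\<^bsub>G\<^esub>} \<noteq> {}"
      by blast
    then show "k \<in> \<pi> ` {x \<in> carrier H. f x \<noteq> \<one>\<^bsub>G\<^esub>}" by auto
  qed
  then have "finite {k \<in> carrier K. push f k \<noteq> \<one>\<^bsub>G\<^esub>}"
    using finite_support[OF assms] finite_surj by blast
  moreover have "push f \<in> carrier K \<rightarrow>\<^sub>E carrier G"
    using B_restrict[OF assms] by (auto simp: fibre_prod_def)
  ultimately show ?thesis by (simp add: K.carrier_B)
qed

lemma push_mult:
  assumes "f \<in> carrier B" "g \<in> carrier B"
  shows "push (f \<otimes>\<^bsub>B\<^esub> g) = push f \<otimes>\<^bsub>K.B\<^esub> push g"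
proof -
  have "gfinprod G (f \<otimes>\<^bsub>B\<^esub> g) {x \<in> carrier H. \<pi> x = k} =
      gfinprod G f {x \<in> carrier H. \<pi> x = k} \<otimes>\<^bsub>G\<^esub> gfinprod G g {x \<in> carrier H. \<pi> x = k}" for k
  proof -
    have "gfinprod G (f \<otimes>\<^bsub>B\<^esub> g) {x \<in> carrier H. \<pi> x = k} =
        gfinprod G (\<lambda>x. f x \<otimes>\<^bsub>G\<^esub> g x) {x \<in> carrier H. \<pi> x = k}"
      using assms by (intro G.gfinprod_cong) (auto simp: B_apply_closed)
    then show ?thesis
      using G.gfinprod_distrib[OF finite_support_fibre[OF assms(1)] finite_support_fibre[OF assms(2)]
          B_restrict[OF assms(1)] B_restrict[OF assms(2)]] by simp
  qed
  then show ?thesis by (simp add: fibre_prod_def fun_eq_iff)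
qed

text \<open>Left multiplication by the inverse of \<open>h\<close> maps the fibre over
  \<open>k\<close> bijectively onto the fibre over its translate by the inverse of
  \<open>\<pi> h\<close>.\<close>

lemma push_shift:
  assumes h: "h \<in> carrier H" and f: "f \<in> carrier B"
  shows "push (regular_shift H h f) = regular_shift K (\<pi> h) (push f)"
proof
  fix k
  show "push (regular_shift H h f) k = regular_shift K (\<pi> h) (push f) k"
  proof (cases "k \<in> carrier K")
    case True
    let ?k = "inv\<^bsub>K\<^esub> \<pi> h \<otimes>\<^bsub>K\<^esub> k"
    have bij: "bij_betw (\<lambda>x. inv\<^bsub>H\<^esub> h \<otimes>\<^bsub>H\<^esub> x) {x \<in> carrier H. \<pi> x = k} {x \<in> carrier H. \<pi> x = ?k}"
      by (rule bij_betwI[where g = "\<lambda>x. h \<otimes>\<^bsub>H\<^esub> x"])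
        (use h True in \<open>auto simp flip: H.m_assoc \<pi>.H.m_assoc\<close>)
    have "gfinprod G (regular_shift H h f) {x \<in> carrier H. \<pi> x = k} =
        gfinprod G (\<lambda>x. f (inv\<^bsub>H\<^esub> h \<otimes>\<^bsub>H\<^esub> x)) {x \<in> carrier H. \<pi> x = k}"
      using h f by (intro G.gfinprod_cong) (auto simp: regular_shift_def B_apply_closed)
    also have "\<dots> = gfinprod G f {x \<in> carrier H. \<pi> x = ?k}"
      using G.gfinprod_reindex[OF bij B_restrict[OF f]] .
    finally show ?thesis
      using True h by (simp add: fibre_prod_def regular_shift_def)
  qed (simp add: fibre_prod_def regular_shift_def)
qed

lemma push_hom: "(\<lambda>(f, h). (push f, \<pi> h)) \<in> hom W K.W"
  by (auto simp: hom_def carrier_W K.carrier_W mult_W K.mult_W push_closed push_mult push_shift shift_closed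
      simp del: mult_sum_group)

text \<open>The fibre through \<open>x\<close> meets \<open>T\<close> only in \<open>x\<close>, so
  its product has at most one nontrivial factor.\<close>

lemma push_apply:
  assumes "f \<in> carrier B" "{x \<in> carrier H. f x \<noteq> \<one>\<^bsub>G\<^esub>} \<subseteq> T" "inj_on \<pi> T" "x \<in> T" "T \<subseteq> carrier H"
  shows "push f (\<pi> x) = f x"
proof -
  have x: "x \<in> carrier H" using assms by blast
  have "{y \<in> {y \<in> carrier H. \<pi> y = \<pi> x}. f y \<noteq> \<one>\<^bsub>G\<^esub>} = (if f x = \<one>\<^bsub>G\<^esub> then {} else {x})"
    using assms(2-4) x by (auto dest: inj_onD)
  then show ?thesis
    using x B_apply_closed[OF assms(1) x] by (simp add: fibre_prod_def gfinprod_def)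
qed

lemma push_inj:
  assumes "f \<in> carrier B" "g \<in> carrier B" "{x \<in> carrier H. f x \<noteq> \<one>\<^bsub>G\<^esub>} \<subseteq> T"
    "{x \<in> carrier H. g x \<noteq> \<one>\<^bsub>G\<^esub>} \<subseteq> T" "inj_on \<pi> T" "T \<subseteq> carrier H" "push f = push g"
  shows "f = g"
proof (rule B_eqI[OF assms(1,2)])
  fix x assume x: "x \<in> carrier H"
  show "f x = g x"
  proof (cases "x \<in> T")
    case True
    then show ?thesis
      using push_apply[OF assms(1,3,5) _ assms(6)] push_apply[OF assms(2,4,5) _ assms(6)] assms(7) by metis
  next
    case False
    then have "f x = \<one>\<^bsub>G\<^esub>" "g x = \<one>\<^bsub>G\<^esub>"
      using assms(3,4) x by blast+
    then show ?thesis by simp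
  qed
qed

end

section \<open>Abelian base group\<close>

context wreath
begin

text \<open>If \<open>h\<close> had infinite order, the support of \<open>f\<close> would contain an
  infinite orbit of left multiplication by \<open>h\<close>.\<close>

lemma shift_fixed_imp_finite_order:
  assumes f: "f \<in> carrier B" "f \<noteq> \<one>\<^bsub>B\<^esub>" and h: "h \<in> carrier H" and fixed: "regular_shift H h f = f"
  shows "H.ord h \<noteq> 0"
proof
  assume ord: "H.ord h = 0"
  obtain x where x: "x \<in> carrier H" "f x \<noteq> \<one>\<^bsub>G\<^esub>"
    using B_eqI[OF f(1) B.one_closed] f(2) by auto
  have "f (h [^]\<^bsub>H\<^esub> n \<otimes>\<^bsub>H\<^esub> x) = f x" for n :: nat
  proof (induction n)
    case (Suc n)
    have "h [^]\<^bsub>H\<^esub> Suc n \<otimes>\<^bsub>H\<^esub> x = h \<otimes>\<^bsub>H\<^esub> (h [^]\<^bsub>H\<^esub> n \<otimes>\<^bsub>H\<^esub> x)"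
      using H.nat_pow_Suc2[OF h] h x(1) by (simp add: H.m_assoc)
    moreover have "f (h \<otimes>\<^bsub>H\<^esub> y) = f y" if "y \<in> carrier H" for y
      using fun_cong[OF fixed, of "h \<otimes>\<^bsub>H\<^esub> y"] h that
      by (simp add: regular_shift_def flip: H.m_assoc)
    ultimately show ?case using Suc h x(1) by simp
  qed (use x in simp)
  then have "(\<lambda>n::nat. h [^]\<^bsub>H\<^esub> n \<otimes>\<^bsub>H\<^esub> x) ` UNIV \<subseteq> {x \<in> carrier H. f x \<noteq> \<one>\<^bsub>G\<^esub>}"
    using h x by auto
  moreover have "inj (\<lambda>n::nat. h [^]\<^bsub>H\<^esub> n \<otimes>\<^bsub>H\<^esub> x)"
  proof (rule injI)
    fix m n :: nat assume "h [^]\<^bsub>H\<^esub> m \<otimes>\<^bsub>H\<^esub> x = h [^]\<^bsub>H\<^esub> n \<otimes>\<^bsub>H\<^esub> x"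
    then have "h [^]\<^bsub>H\<^esub> int m = h [^]\<^bsub>H\<^esub> int n"
      using h x(1) by (simp add: int_pow_int)
    then show "m = n" using ord h by (simp add: H.int_pow_eq)
  qed
  ultimately show False
    using finite_support[OF f(1)] by (meson finite_imageD finite_subset infinite_UNIV_nat)
qed

text \<open>As the base group is abelian, conjugation by \<open>(f', h)\<close> acts on it through
  \<open>h\<close> alone.\<close>

lemma base_conj:
  assumes "comm_group G" "f' \<in> carrier B" "h \<in> carrier H" "f \<in> carrier B"
  shows "(regular_shift H h f, \<one>\<^bsub>H\<^esub>) \<otimes>\<^bsub>W\<^esub> (f', h) = (f', h) \<otimes>\<^bsub>W\<^esub> (f, \<one>\<^bsub>H\<^esub>)"
proof -
  interpret G: comm_group G by fact
  show ?thesis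
    using assms by (auto simp: mult_W shift_one shift_closed B_apply_closed G.m_comm)
qed

text \<open>Pushing forward to a finite quotient of \<open>H\<close> reduces to a finite top group.
  What remains is that the image of \<open>(f, 1)\<close> is not a power of the image of
  \<open>w\<close>.\<close>

lemma separable_abelian_base:
  assumes "comm_group G" "cyclic_subgroup_separable G" "cyclic_subgroup_separable H"
  shows "cyclic_subgroup_separable W"
proof (rule wreath_separable_if_base_separated)
  fix w f assume w: "w \<in> carrier W" and f: "f \<in> carrier B"
    and neq: "\<And>k::int. (f, \<one>\<^bsub>H\<^esub>) \<noteq> w [^]\<^bsub>W\<^esub> k"
  interpret G: comm_group G by fact
  define h where "h = snd w"
  define n where "n = int (H.ord h)"
  have h: "h \<in> carrier H" using w by (auto simp: carrier_W h_def)
  obtain F where F: "F \<in> carrier B" "\<And>q. w [^]\<^bsub>W\<^esub> (n * q) = (F [^]\<^bsub>B\<^esub> q, \<one>\<^bsub>H\<^esub>)"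
    using W_int_pow_ord[OF w] n_def h_def by metis
  define f' where "f' = regular_shift H h f"
  have f': "f' \<in> carrier B" using shift_closed[OF h f] by (simp add: f'_def)
  let ?supp = "\<lambda>f. {x \<in> carrier H. f x \<noteq> \<one>\<^bsub>G\<^esub>}"
  \<comment> \<open>The supports make \<open>push\<close> faithful on \<open>f\<close>, on its shift
    and on the powers of \<open>F\<close>; the powers of \<open>h\<close> keep its order
    \<open>n\<close> in the quotient. The last set is empty for \<open>n = 0\<close>.\<close>
  define T where "T = ?supp f \<union> ?supp f' \<union> ?supp F \<union> (\<lambda>i. h [^]\<^bsub>H\<^esub> i) ` {0..<n}"
  have T: "finite T" "T \<subseteq> carrier H"
    using finite_support f f' F(1) h by (auto simp: T_def)
  then obtain N where N: "finite_index_normal N H" and inj: "inj_on (\<lambda>x. N #>\<^bsub>H\<^esub> x) T"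
    using finite_index_normal_inj_on[OF H.is_group assms(3)] by blast
  let ?\<pi> = "\<lambda>x. N #>\<^bsub>H\<^esub> x"
  interpret wreath_quotient G H "H Mod N" ?\<pi>
    using group_Mod[OF N] hom_Mod[OF N]
    by (simp add: wreath_quotient_def group_hom_def group_hom_axioms_def wreath_axioms assms(1))
  define \<phi> where "\<phi> = (\<lambda>(f, h). (push f, ?\<pi> h))"
  have \<phi>: "\<phi> \<in> hom W K.W"
    using push_hom by (simp add: \<phi>_def)
  interpret \<phi>: group_hom W K.W \<phi>
    using \<phi> by (simp add: group_hom_def group_hom_axioms_def)
  have u: "(f, \<one>\<^bsub>H\<^esub>) \<in> carrier W" using f by (simp add: carrier_W)
  have "\<phi> (f, \<one>\<^bsub>H\<^esub>) \<noteq> \<phi> (w [^]\<^bsub>W\<^esub> k)" for k :: int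
  proof
    assume eq: "\<phi> (f, \<one>\<^bsub>H\<^esub>) = \<phi> (w [^]\<^bsub>W\<^esub> k)"
    show False
    proof (cases "n = 0")
      case True
      \<comment> \<open>The image of \<open>(f, 1)\<close> would commute with that of \<open>w\<close>, although \<open>h\<close> moves \<open>f\<close>.\<close>
      have v: "(f', \<one>\<^bsub>H\<^esub>) \<in> carrier W" using f' by (simp add: carrier_W)
      have "(f', \<one>\<^bsub>H\<^esub>) \<otimes>\<^bsub>W\<^esub> w = w \<otimes>\<^bsub>W\<^esub> (f, \<one>\<^bsub>H\<^esub>)"
        using base_conj[OF assms(1) _ h f, of "fst w"] w by (auto simp: f'_def h_def carrier_W)
      then have "\<phi> (f', \<one>\<^bsub>H\<^esub>) \<otimes>\<^bsub>K.W\<^esub> \<phi> w = \<phi> w \<otimes>\<^bsub>K.W\<^esub> \<phi> (w [^]\<^bsub>W\<^esub> k)"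
        using u v w by (metis \<phi>.hom_mult eq)
      also have "\<dots> = \<phi> (w \<otimes>\<^bsub>W\<^esub> w [^]\<^bsub>W\<^esub> k)"
        using w by (simp only: \<phi>.hom_mult W.int_pow_closed)
      also have "w \<otimes>\<^bsub>W\<^esub> w [^]\<^bsub>W\<^esub> k = w [^]\<^bsub>W\<^esub> k \<otimes>\<^bsub>W\<^esub> w"
        using W.int_pow_mult[OF w, of 1 k] W.int_pow_mult[OF w, of k 1] w by (simp add: add.commute)
      also have "\<phi> \<dots> = \<phi> (f, \<one>\<^bsub>H\<^esub>) \<otimes>\<^bsub>K.W\<^esub> \<phi> w"
        using w by (simp only: \<phi>.hom_mult W.int_pow_closed eq)
      finally have "\<phi> (f', \<one>\<^bsub>H\<^esub>) = \<phi> (f, \<one>\<^bsub>H\<^esub>)"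
        using u v w by (metis K.W.r_cancel \<phi>.hom_closed)
      then have "push f' = push f" by (simp add: \<phi>_def)
      then have "f' = f"
        using push_inj[OF f' f _ _ inj T(2)] by (auto simp: T_def)
      \<comment> \<open>The exponent 0 is among those that \<open>neq\<close> excludes.\<close>
      moreover have "f \<noteq> \<one>\<^bsub>B\<^esub>"
        using neq[of 0] by (simp add: one_W)
      ultimately show False
        using shift_fixed_imp_finite_order[OF f _ h] True by (simp add: f'_def n_def)
    next
      case False
      then have n: "n > 0" by (simp add: n_def)
      \<comment> \<open>Reduction modulo \<open>n\<close> brings the exponent into the range that
        \<open>T\<close> covers.\<close>
      have hk: "h [^]\<^bsub>H\<^esub> k = h [^]\<^bsub>H\<^esub> (k mod n)"
        using h by (simp add: H.int_pow_eq n_def) (metis dvd_minus_mod dvd_minus_iff minus_diff_eq)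
      have "?\<pi> (h [^]\<^bsub>H\<^esub> (k mod n)) = ?\<pi> (h [^]\<^bsub>H\<^esub> (0::int))"
        using arg_cong[OF eq, of snd] w by (simp add: \<phi>_def case_prod_beta snd_int_pow hk flip: h_def)
      moreover have "h [^]\<^bsub>H\<^esub> i \<in> T" if "0 \<le> i" "i < n" for i
        using that by (auto simp: T_def)
      ultimately have "h [^]\<^bsub>H\<^esub> (k mod n) = h [^]\<^bsub>H\<^esub> (0::int)"
        using n by (intro inj_onD[OF inj]) (simp_all del: int_pow_0)
      then have "n dvd k"
        using h hk by (simp add: n_def flip: H.int_pow_eq_id)
      then obtain q where "k = n * q" ..
      then have q: "w [^]\<^bsub>W\<^esub> k = (F [^]\<^bsub>B\<^esub> q, \<one>\<^bsub>H\<^esub>)"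
        using F(2) by simp
      \<comment> \<open>Hence one \<open>T\<close>, chosen before \<open>q\<close> is known, serves
        for all powers of \<open>F\<close>.\<close>
      have "?supp (F [^]\<^bsub>B\<^esub> q) \<subseteq> ?supp F"
        using F(1) by (auto simp: B_int_pow_apply)
      then have "f = F [^]\<^bsub>B\<^esub> q"
        using eq push_inj[OF f B.int_pow_closed[OF F(1)] _ _ inj T(2)] by (auto simp: q T_def \<phi>_def)
      then show False using neq q by metis
    qed
  qed
  moreover have "cyclic_subgroup_separable K.W"
    using K.separable_finite_top assms(2) finite_carrier_Mod[OF N] .
  ultimately show "finitely_separated W w (f, \<one>\<^bsub>H\<^esub>)"
    by (intro finitely_separated_hom[OF W.is_group K.W.is_group _ \<phi> w u])
qed fact

end

theorem theorem1p7:
  fixes G :: "('g, 'c) monoid_scheme" and H :: "('h, 'd) monoid_scheme"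
  assumes "group G" and "group H"
  shows "cyclic_subgroup_separable (wreath_product G H) \<longleftrightarrow>
    cyclic_subgroup_separable G \<and> cyclic_subgroup_separable H \<and>
    (comm_group G \<or> finite (carrier H))"
proof -
  interpret wreath G H
    using assms by (simp add: wreath_def)
  show ?thesis
  proof
    assume W: "cyclic_subgroup_separable W"
    \<comment> \<open>Both factors embed: \<open>G\<close> as the coordinate copy at the identity
      and \<open>H\<close> as the top group.\<close>
    have "cyclic_subgroup_separable G"
      using cyclic_subgroup_separable_inj_hom[OF assms(1) W.is_group W single_hom single_inj[OF H.one_closed]] .
    moreover have "cyclic_subgroup_separable H"
      using cyclic_subgroup_separable_inj_hom[OF assms(2) W.is_group W top_hom top_inj] .
    ultimately show "cyclic_subgroup_separable G \<and> cyclic_subgroup_separable H \<and>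
        (comm_group G \<or> finite (carrier H))"
      using comm_if_separable[OF W] by blast
  qed (auto intro: separable_finite_top separable_abelian_base)
qed

end
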